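(* Let $b,c,\beta,\mu,\nu,g$ and the operator $L$ with domain $\mathcal D(L)$ be as in the context, and let $V_1(x)=x$ for $x\ge0$. Suppose that $$\int_1^\infty z\,\mu(dz)+\int_1^\infty z\,\nu(dz)<\infty .$$ Then $V_1\in\mathcal D(L)$, and there exist constants $C_0,C_1>0$ such that $LV_1(x)\le C_0-C_1V_1(x)$ for all $x\ge0$ if and only if $$\liminf_{x\to\infty}\frac{g(x)}{x}+b-\int_1^\infty z\,\mu(dz)>0 .$$
   Context: $b\in\mathbb R$, $c\ge0$, $\beta\ge0$ are constants; $\mu$ and $\nu$ are measures on $(0,\infty)$ with $\int_0^\infty(1\wedge z^2)\mu(dz)<\infty$ and $\int_0^\infty(1\wedge z)\nu(dz)<\infty$; $g$ is a nondecreasing continuous function on $[0,\infty)$ with $g(0)=0$. The convention $\int_1^\infty=\int_{(1,\infty)}$ is used. For $f\in C^2(\mathbb R_+)$ and $x\ge 0$, with $\Delta_zf(x)=f(x+z)-f(x)$, $$Lf(x)=cxf''(x)+x\int_0^\infty[\Delta_zf(x)-zf'(x)\mathbf 1_{\{z\le1\}}]\mu(dz)+[\beta-bx-g(x)]f'(x)+\int_0^\infty\Delta_zf(x)\nu(dz).$$ $\mathcal D(L)$ is the linear space of $f\in C^2(\mathbb R_+)$ such that the two integrals converge and define continuous functions of $x\in\mathbb R_+$. *)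

theory Defs
  imports "HOL-Analysis.Analysis"
begin

text \<open>Functions on \<open>\<real>\<^sub>+ = [0,\<infinity>)\<close> are modelled as functions \<open>real \<Rightarrow> real\<close> whose values on the
  negative half-line are irrelevant. Derivatives are therefore taken within \<open>{0..}\<close>, hence are
  one-sided at \<open>0\<close>.\<close>

definition D1 :: "(real \<Rightarrow> real) \<Rightarrow> real \<Rightarrow> real" where
  "D1 f x = vector_derivative f (at x within {0..})"

definition D2 :: "(real \<Rightarrow> real) \<Rightarrow> real \<Rightarrow> real" where
  "D2 f = D1 (D1 f)"

definition C2 :: "(real \<Rightarrow> real) set" where
  "C2 = {f. f differentiable_on {0..} \<and> D1 f differentiable_on {0..} \<and> continuous_on {0..} (D2 f)}"

definition Delta :: "real \<Rightarrow> (real \<Rightarrow> real) \<Rightarrow> real \<Rightarrow> real" where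
  "Delta z f x = f (x + z) - f x"

definition mu_integrand :: "(real \<Rightarrow> real) \<Rightarrow> real \<Rightarrow> real \<Rightarrow> real" where
  "mu_integrand f x z = Delta z f x - z * D1 f x * indicator {..1} z"

text \<open>The measures \<open>\<mu>\<close> and \<open>\<nu>\<close> have underlying space \<open>(0,\<infinity>)\<close>, so that an integral over
  the whole space is \<open>\<integral>\<^sub>0\<^sup>\<infinity>\<close>.\<close>

definition L_op ::
  "real \<Rightarrow> real \<Rightarrow> real \<Rightarrow> real measure \<Rightarrow> real measure \<Rightarrow> (real \<Rightarrow> real) \<Rightarrow>
    (real \<Rightarrow> real) \<Rightarrow> real \<Rightarrow> real" where
  "L_op b c \<beta> \<mu> \<nu> g f x =
     c * x * D2 f x + x * (\<integral>z. mu_integrand f x z \<partial>\<mu>)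
     + (\<beta> - b * x - g x) * D1 f x + (\<integral>z. Delta z f x \<partial>\<nu>)"

definition L_dom :: "real measure \<Rightarrow> real measure \<Rightarrow> (real \<Rightarrow> real) set" where
  "L_dom \<mu> \<nu> = {f \<in> C2.
     (\<forall>x\<ge>0. integrable \<mu> (\<lambda>z. mu_integrand f x z) \<and> integrable \<nu> (\<lambda>z. Delta z f x)) \<and>
     continuous_on {0..} (\<lambda>x. \<integral>z. mu_integrand f x z \<partial>\<mu>) \<and>
     continuous_on {0..} (\<lambda>x. \<integral>z. Delta z f x \<partial>\<nu>)}"

definition V1 :: "real \<Rightarrow> real" where
  "V1 x = x"

end

theory Submission
  imports Defs
begin

text \<open>
  The function \<open>V1\<close> has first derivative \<open>1\<close> and second derivative \<open>0\<close> on the half-line, and its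
  increments \<open>\<Delta>\<^sub>z V1 (x) = z\<close> do not depend on \<open>x\<close>. Hence the diffusion term vanishes, and in the
  \<open>\<mu>\<close>-integrand the compensator cancels all jumps of size at most \<open>1\<close>, which leaves \<open>z\<close> on
  \<open>(1,\<infinity>)\<close>. Both integrals are therefore constants. They are finite by the moment assumption on
  the large jumps and by \<open>\<integral> (1 \<and> z) \<nu>(dz) < \<infinity>\<close> for the small jumps of \<open>\<nu>\<close>, so \<open>V1\<close> lies in
  the domain (\<open>V1_in_L_dom\<close>), and with \<open>m = \<integral>\<^sub>1\<^sup>\<infinity> z \<mu>(dz)\<close> and \<open>n = \<integral>\<^sub>0\<^sup>\<infinity> z \<nu>(dz)\<close>
  one gets (\<open>L_op_V1\<close>)
  \<open>L V1 (x) = (\<beta> + n) + (m - b) x - g x\<close>.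

  What remains is a statement about one real function (\<open>drift_iff_Liminf\<close>): \<open>a + k x - g x\<close> is
  bounded by \<open>C0 - C1 x\<close> with some \<open>C1 > 0\<close> exactly if \<open>g x / x\<close> stays above \<open>k\<close> by a fixed margin
  for large \<open>x\<close>, that is, \<open>liminf g x / x > k\<close>. Dividing the bound by \<open>x\<close> gives one direction. For
  the other, the margin serves as \<open>C1\<close>, and on the remaining bounded interval of small \<open>x\<close> the
  inequality \<open>g \<ge> 0\<close> (from monotonicity and \<open>g 0 = 0\<close>) allows \<open>C0\<close> to absorb everything.
\<close>

lemma at_within_half_line_neq_bot:
  fixes x :: real
  assumes "x \<ge> 0"
  shows "at x within {0..} \<noteq> bot"
proof -
  have "at_right x \<le> at x within {0..}"
    using assms by (intro at_le) auto
  then show ?thesis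
    using trivial_limit_at_right_real[of x] by (auto simp: bot_unique)
qed

lemma D1_V1:
  assumes "x \<ge> 0"
  shows "D1 V1 x = 1"
proof -
  have "(V1 has_vector_derivative 1) (at x within {0..})"
    unfolding V1_def[abs_def] by (rule has_vector_derivative_id)
  with at_within_half_line_neq_bot[OF assms] show ?thesis
    unfolding D1_def by (rule vector_derivative_within)
qed

text \<open>Outside the half-line \<open>D1 V1\<close> has unspecified values, so the second derivative has to be taken
  from a one-sided limit inside \<open>{0..}\<close>, where \<open>D1 V1\<close> coincides with the constant \<open>1\<close>.\<close>

lemma D1_V1_has_derivative_0:
  assumes "x \<ge> 0"
  shows "(D1 V1 has_vector_derivative 0) (at x within {0..})"
proof (rule has_vector_derivative_transform)
  show "((\<lambda>_. 1) has_vector_derivative 0) (at x within {0..})"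
    by (rule has_vector_derivative_const)
qed (use assms in \<open>auto simp: D1_V1\<close>)

lemma D2_V1:
  assumes "x \<ge> 0"
  shows "D2 V1 x = 0"
  unfolding D2_def D1_def[of "D1 V1"]
  using at_within_half_line_neq_bot[OF assms] D1_V1_has_derivative_0[OF assms]
  by (rule vector_derivative_within)

lemma V1_in_C2: "V1 \<in> C2"
proof -
  have "V1 differentiable_on {0..}"
    by (simp add: V1_def[abs_def])
  moreover have "D1 V1 differentiable_on {0..}"
    unfolding differentiable_on_def
    using D1_V1_has_derivative_0 differentiableI_vector by fastforce
  moreover have "continuous_on {0..} (D2 V1)"
    by (subst continuous_on_cong[OF refl, of _ _ "\<lambda>_. 0"]) (auto simp: D2_V1)
  ultimately show ?thesis
    by (simp add: C2_def)
qed

lemma Delta_V1: "Delta z V1 x = z"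
  by (simp add: Delta_def V1_def)

lemma mu_integrand_V1:
  assumes "x \<ge> 0"
  shows "mu_integrand V1 x = (\<lambda>z. indicator {1<..} z *\<^sub>R z)"
  by (auto simp: fun_eq_iff mu_integrand_def Delta_V1 D1_V1[OF assms] indicator_def)

lemma V1_in_L_dom:
  assumes "set_integrable \<mu> {1<..} (\<lambda>z. z)" and "integrable \<nu> (\<lambda>z. z)"
  shows "V1 \<in> L_dom \<mu> \<nu>"
proof -
  have "continuous_on {0..} (\<lambda>x. \<integral>z. mu_integrand V1 x z \<partial>\<mu>)"
    by (subst continuous_on_cong[OF refl, of _ _ "\<lambda>_. LINT z:{1<..}|\<mu>. z"])
       (auto simp: mu_integrand_V1 set_lebesgue_integral_def)
  with assms V1_in_C2 show ?thesis
    by (auto simp: L_dom_def mu_integrand_V1 Delta_V1 set_integrable_def)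
qed

lemma L_op_V1:
  assumes "x \<ge> 0"
  shows "L_op b c \<beta> \<mu> \<nu> g V1 x
    = (\<beta> + (\<integral>z. z \<partial>\<nu>)) + ((LINT z:{1<..}|\<mu>. z) - b) * x - g x"
  using assms
  by (simp add: L_op_def D1_V1 D2_V1 mu_integrand_V1 Delta_V1
      set_lebesgue_integral_def algebra_simps)

lemma set_integrable_id_greaterThan:
  fixes \<mu> :: "real measure"
  assumes sets: "sets \<mu> = sets (restrict_space borel {0<..})"
    and finite: "(\<integral>\<^sup>+z\<in>{1<..}. ennreal z \<partial>\<mu>) < \<infinity>"
  shows "set_integrable \<mu> {1<..} (\<lambda>z. z)"
  unfolding set_integrable_def
proof (rule integrableI_nonneg)
  have "(\<lambda>z::real. indicator {1<..} z *\<^sub>R z) \<in> borel_measurable borel"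
    by measurable
  then show "(\<lambda>z. indicator {1<..} z *\<^sub>R z) \<in> borel_measurable \<mu>"
    using measurable_restrict_space1 measurable_cong_sets[OF sets refl] by blast
  show "AE z in \<mu>. 0 \<le> indicator {1<..} z *\<^sub>R z"
    by (auto simp: indicator_def)
  have "(\<integral>\<^sup>+z. ennreal (indicator {1<..} z *\<^sub>R z) \<partial>\<mu>) = (\<integral>\<^sup>+z\<in>{1<..}. ennreal z \<partial>\<mu>)"
    by (intro nn_integral_cong) (auto simp: indicator_def)
  with finite show "(\<integral>\<^sup>+z. ennreal (indicator {1<..} z *\<^sub>R z) \<partial>\<mu>) < \<infinity>"
    by simp
qed

text \<open>Small and large jumps are controlled by different hypotheses, through
  \<open>z \<le> min 1 z + z * indicator {1<..} z\<close>.\<close>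

lemma integrable_id_positive:
  fixes \<nu> :: "real measure"
  assumes sets: "sets \<nu> = sets (restrict_space borel {0<..})"
    and small: "(\<integral>\<^sup>+z. ennreal (min 1 z) \<partial>\<nu>) < \<infinity>"
    and large: "(\<integral>\<^sup>+z\<in>{1<..}. ennreal z \<partial>\<nu>) < \<infinity>"
  shows "integrable \<nu> (\<lambda>z. z)"
proof (rule integrableI_nonneg)
  have meas: "f \<in> borel_measurable \<nu>" if "f \<in> borel_measurable borel"
    for f :: "real \<Rightarrow> 'a::topological_space"
    using that measurable_restrict_space1 measurable_cong_sets[OF sets refl] by blast
  show "(\<lambda>z. z) \<in> borel_measurable \<nu>"
    by (rule meas) measurable
  have "space \<nu> = {0<..}"
    using sets_eq_imp_space_eq[OF sets] by (simp add: space_restrict_space)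
  then show "AE z in \<nu>. 0 \<le> z"
    by (intro AE_I2) auto
  have "(\<integral>\<^sup>+z. ennreal z \<partial>\<nu>)
      \<le> (\<integral>\<^sup>+z. ennreal (min 1 z) + ennreal z * indicator {1<..} z \<partial>\<nu>)"
    by (intro nn_integral_mono) (auto simp: indicator_def min_def)
  also have "\<dots> = (\<integral>\<^sup>+z. ennreal (min 1 z) \<partial>\<nu>) + (\<integral>\<^sup>+z\<in>{1<..}. ennreal z \<partial>\<nu>)"
    by (intro nn_integral_add meas) measurable
  also have "\<dots> < \<infinity>"
    using small large by simp
  finally show "(\<integral>\<^sup>+z. ennreal z \<partial>\<nu>) < \<infinity>" .
qed

text \<open>Dividing by \<open>x\<close> turns the linear bound into \<open>g x / x \<ge> k + C1 - O(1/x)\<close>; conversely, any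
  level \<open>r\<close> strictly between \<open>k\<close> and the lower limit yields the rate \<open>C1 = r - k\<close>.\<close>

lemma drift_iff_Liminf:
  fixes a k :: real and g :: "real \<Rightarrow> real"
  assumes nonneg: "\<And>x. x \<ge> 0 \<Longrightarrow> g x \<ge> 0"
  shows "(\<exists>C0 C1. C0 > 0 \<and> C1 > 0 \<and> (\<forall>x\<ge>0. a + k * x - g x \<le> C0 - C1 * x)) \<longleftrightarrow>
    ereal k < Liminf at_top (\<lambda>x. ereal (g x / x))"
    (is "?drift \<longleftrightarrow> ?liminf")
proof
  assume ?drift
  then obtain C0 C1 where "C1 > 0" and
    bound: "\<And>x. x \<ge> 0 \<Longrightarrow> a + k * x - g x \<le> C0 - C1 * x"
    by blast
  have "eventually (\<lambda>x. ereal (k + C1 / 2) \<le> ereal (g x / x)) at_top"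
    \<comment> \<open>Beyond this threshold half of the rate \<open>C1\<close> pays for the constant \<open>C0 - a\<close>.\<close>
    using eventually_gt_at_top[of "max 0 (2 * (C0 - a) / C1)"]
  proof eventually_elim
    case (elim x)
    then have "x > 0" and "2 * (C0 - a) < C1 * x"
      using \<open>C1 > 0\<close> by (auto simp: field_simps)
    with bound[of x] have "(k + C1 / 2) * x \<le> g x"
      by (simp add: algebra_simps)
    with \<open>x > 0\<close> show ?case
      by (simp add: pos_le_divide_eq)
  qed
  then have "ereal (k + C1 / 2) \<le> Liminf at_top (\<lambda>x. ereal (g x / x))"
    by (rule Liminf_bounded)
  moreover have "ereal k < ereal (k + C1 / 2)"
    using \<open>C1 > 0\<close> by simp
  ultimately show ?liminf
    by (rule less_le_trans[rotated])
next
  assume ?liminf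
  then obtain r where "k < r" and r: "ereal r < Liminf at_top (\<lambda>x. ereal (g x / x))"
    using ereal_dense2[of "ereal k"] by auto
  from less_LiminfD[OF r] obtain N0 where N0: "\<And>x. x \<ge> N0 \<Longrightarrow> r < g x / x"
    by (auto simp: eventually_at_top_linorder)
  define N where "N = max 1 N0"
  define C0 where "C0 = \<bar>a\<bar> + \<bar>r\<bar> * N + 1"
  have "N > 0"
    by (simp add: N_def)
  then have "\<bar>r\<bar> * N \<ge> 0"
    by simp
  have "r * x - g x \<le> \<bar>r\<bar> * N" if "x \<ge> 0" for x
  proof (cases "x \<le> N")
    case True
    have "r * x \<le> \<bar>r\<bar> * N"
      using True that by (intro mult_mono) auto
    with nonneg[OF that] show ?thesis
      by linarith
  next
    case False
    then have "r * x < g x"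
      using N0[of x] \<open>N > 0\<close> by (simp add: N_def pos_less_divide_eq)
    with \<open>\<bar>r\<bar> * N \<ge> 0\<close> show ?thesis
      by linarith
  qed
  then have "\<forall>x\<ge>0. a + k * x - g x \<le> C0 - (r - k) * x"
    by (fastforce simp: C0_def algebra_simps)
  moreover have "C0 > 0"
    using \<open>\<bar>r\<bar> * N \<ge> 0\<close> by (simp add: C0_def)
  ultimately show ?drift
    using \<open>k < r\<close> by (intro exI[of _ C0] exI[of _ "r - k"]) simp
qed

theorem proposition1p2:
  fixes b c \<beta> :: real and \<mu> \<nu> :: "real measure" and g :: "real \<Rightarrow> real"
  assumes "c \<ge> 0" and "\<beta> \<ge> 0"
    and "sets \<mu> = sets (restrict_space borel {0<..})"
    and "sets \<nu> = sets (restrict_space borel {0<..})"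
    and "(\<integral>\<^sup>+z. ennreal (min 1 (z\<^sup>2)) \<partial>\<mu>) < \<infinity>"
    and "(\<integral>\<^sup>+z. ennreal (min 1 z) \<partial>\<nu>) < \<infinity>"
    and "mono_on {0..} g" and "continuous_on {0..} g" and "g 0 = 0"
    and "(\<integral>\<^sup>+z\<in>{1<..}. ennreal z \<partial>\<mu>) + (\<integral>\<^sup>+z\<in>{1<..}. ennreal z \<partial>\<nu>) < \<infinity>"
  shows "V1 \<in> L_dom \<mu> \<nu> \<and>
    ((\<exists>C0 C1. C0 > 0 \<and> C1 > 0 \<and> (\<forall>x\<ge>0. L_op b c \<beta> \<mu> \<nu> g V1 x \<le> C0 - C1 * V1 x)) \<longleftrightarrow>
     Liminf at_top (\<lambda>x. ereal (g x / x)) + ereal b - ereal (LINT z:{1<..}|\<mu>. z) > 0)"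
proof
  have "(\<integral>\<^sup>+z\<in>{1<..}. ennreal z \<partial>\<mu>) < \<infinity>" and "(\<integral>\<^sup>+z\<in>{1<..}. ennreal z \<partial>\<nu>) < \<infinity>"
    using assms(10) by (auto simp: ennreal_add_less_top)
  then show "V1 \<in> L_dom \<mu> \<nu>"
    using assms(3,4,6)
    by (intro V1_in_L_dom set_integrable_id_greaterThan integrable_id_positive)
next
  let ?m = "LINT z:{1<..}|\<mu>. z" and ?liminf = "Liminf at_top (\<lambda>x. ereal (g x / x))"
  have nonneg: "g x \<ge> 0" if "x \<ge> 0" for x
    using mono_onD[OF assms(7), of 0 x] that assms(9) by simp
  have "(\<exists>C0 C1. C0 > 0 \<and> C1 > 0 \<and> (\<forall>x\<ge>0. L_op b c \<beta> \<mu> \<nu> g V1 x \<le> C0 - C1 * V1 x)) \<longleftrightarrow>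
    ereal (?m - b) < ?liminf"
    using drift_iff_Liminf[OF nonneg, where a = "\<beta> + (\<integral>z. z \<partial>\<nu>)" and k = "?m - b"]
    by (simp add: L_op_V1 V1_def cong: imp_cong)
  also have "\<dots> \<longleftrightarrow> ?liminf + ereal b - ereal ?m > 0"
    by (cases ?liminf) auto
  finally show "(\<exists>C0 C1. C0 > 0 \<and> C1 > 0 \<and>
      (\<forall>x\<ge>0. L_op b c \<beta> \<mu> \<nu> g V1 x \<le> C0 - C1 * V1 x)) \<longleftrightarrow>
    ?liminf + ereal b - ereal ?m > 0" .
qed

end
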